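(* Let $P$ be a subring of the commutative ring $Q$. A function $a\colon P\to Q$ is a homo-derivation in the sense of El Sofy if and only if there exists a homomorphism $\varphi\colon P\to Q$ such that \[ a(x)=\varphi(x)-x\qquad (x\in P). \]
   Context: Rings are associative and not necessarily unital. A function $f\colon P\to Q$ is a homo-derivation in the sense of El Sofy if it is additive, i.e. $f(x+y)=f(x)+f(y)$ for all $x,y\in P$, and satisfies $f(xy)=f(x)y+xf(y)+f(x)f(y)$ for all $x,y\in P$. A homomorphism $\varphi\colon P\to Q$ is an additive function with $\varphi(xy)=\varphi(x)\varphi(y)$ for all $x,y\in P$ (no condition about preserving a unit is imposed). *)

theory Defs
  imports Main
begin

text \<open>
  The classes \<open>ring\<close> and \<open>comm_ring\<close> are the classes of associative rings without
  a unit assumption. The ambient ring is a whole type, and a function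
  \<open>P \<rightarrow> Q\<close> is represented by a total function of which only the values on \<open>P\<close> matter.
\<close>

definition nonunital_subring :: "'a::ring set \<Rightarrow> bool" where
  "nonunital_subring P \<longleftrightarrow>
     0 \<in> P \<and> (\<forall>x\<in>P. \<forall>y\<in>P. x + y \<in> P) \<and> (\<forall>x\<in>P. - x \<in> P) \<and> (\<forall>x\<in>P. \<forall>y\<in>P. x * y \<in> P)"

definition additive_on :: "'a::ring set \<Rightarrow> ('a \<Rightarrow> 'b::ring) \<Rightarrow> bool" where
  "additive_on P f \<longleftrightarrow> (\<forall>x\<in>P. \<forall>y\<in>P. f (x + y) = f x + f y)"

definition ring_homomorphism_on :: "'a::ring set \<Rightarrow> ('a \<Rightarrow> 'b::ring) \<Rightarrow> bool" where
  "ring_homomorphism_on P f \<longleftrightarrow>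
     additive_on P f \<and> (\<forall>x\<in>P. \<forall>y\<in>P. f (x * y) = f x * f y)"

definition homo_derivation_on :: "'a::ring set \<Rightarrow> ('a \<Rightarrow> 'a) \<Rightarrow> bool" where
  "homo_derivation_on P f \<longleftrightarrow>
     additive_on P f \<and> (\<forall>x\<in>P. \<forall>y\<in>P. f (x * y) = f x * y + x * f y + f x * f y)"

end

theory Submission
  imports Defs
begin

text \<open>
  Adding \<open>x * y\<close> to both sides of the homo-derivation law factorises it:
  \[ a(xy) + xy = a(x)y + xa(y) + a(x)a(y) + xy = (a(x) + x)(a(y) + y). \]
  So \<open>a\<close> satisfies the law exactly when \<open>x \<mapsto> a x + x\<close> is multiplicative, and adding the
  identity also preserves and reflects additivity. The homomorphism \<open>\<phi>\<close> is therefore forced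
  on \<open>P\<close> to be \<open>a\<close> plus the identity, and the theorem follows. Since
  functions on \<open>P\<close> are represented by total functions, the converse direction also uses that
  being a homomorphism depends only on the values on \<open>P\<close>, which holds because \<open>P\<close> is closed
  under both operations.
\<close>

lemma homo_derivation_on_iff_ring_homomorphism_on_add_id:
  fixes P :: "'a::ring set"
  shows "homo_derivation_on P a \<longleftrightarrow> ring_homomorphism_on P (\<lambda>x. a x + x)"
proof -
  have "a (x + y) = a x + a y \<longleftrightarrow> a (x + y) + (x + y) = (a x + x) + (a y + y)" for x y
  proof -
    have "(a x + x) + (a y + y) = (a x + a y) + (x + y)"
      by (simp add: ac_simps)
    then show ?thesis
      by simp
  qed
  moreover have "a (x * y) = a x * y + x * a y + a x * a y
      \<longleftrightarrow> a (x * y) + x * y = (a x + x) * (a y + y)" for x y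
  proof -
    have "(a x + x) * (a y + y) = (a x * y + x * a y + a x * a y) + x * y"
      by (simp add: distrib_left distrib_right ac_simps)
    then show ?thesis
      by simp
  qed
  ultimately show ?thesis
    by (simp add: homo_derivation_on_def ring_homomorphism_on_def additive_on_def)
qed

lemma ring_homomorphism_on_cong:
  assumes "nonunital_subring P" and "\<And>x. x \<in> P \<Longrightarrow> f x = g x"
  shows "ring_homomorphism_on P f \<longleftrightarrow> ring_homomorphism_on P g"
  using assms by (simp add: nonunital_subring_def ring_homomorphism_on_def additive_on_def)

theorem corollary2:
  fixes P :: "'a::comm_ring set" and a :: "'a \<Rightarrow> 'a"
  assumes "nonunital_subring P"
  shows "homo_derivation_on P a \<longleftrightarrow>
    (\<exists>\<phi> :: 'a \<Rightarrow> 'a. ring_homomorphism_on P \<phi> \<and> (\<forall>x\<in>P. a x = \<phi> x - x))"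
proof
  assume "homo_derivation_on P a"
  then have "ring_homomorphism_on P (\<lambda>x. a x + x)"
    by (simp only: homo_derivation_on_iff_ring_homomorphism_on_add_id)
  moreover have "\<forall>x\<in>P. a x = (a x + x) - x"
    by simp
  ultimately show "\<exists>\<phi>. ring_homomorphism_on P \<phi> \<and> (\<forall>x\<in>P. a x = \<phi> x - x)"
    by blast
next
  assume "\<exists>\<phi>. ring_homomorphism_on P \<phi> \<and> (\<forall>x\<in>P. a x = \<phi> x - x)"
  then obtain \<phi> where hom: "ring_homomorphism_on P \<phi>"
    and a_eq: "\<And>x. x \<in> P \<Longrightarrow> a x = \<phi> x - x"
    by blast
  have "ring_homomorphism_on P (\<lambda>x. a x + x) \<longleftrightarrow> ring_homomorphism_on P \<phi>"
    by (rule ring_homomorphism_on_cong[OF assms]) (simp add: a_eq)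
  with hom show "homo_derivation_on P a"
    by (simp only: homo_derivation_on_iff_ring_homomorphism_on_add_id)
qed

end
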